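(* Let $Y$ be a real random variable whose moment generating function $E[e^{tY}]$ exists for $|t|<\rho$ for some $\rho>0$. For every integer $n\ge 0$ and every real $x$, $$\sum_{m=0}^{n}d_{m}^{Y}(x){n \brace m}=\sum_{m=0}^{n}\sum_{l=0}^{m}(-1)^{l}{m \brace l}\binom{n}{m}E[Y^{l}]F_{n-m}(x).$$
   Context: The probabilistic derangement polynomials of type 2 associated with $Y$, denoted $d_n^Y(x)$, are defined by the generating function (for $t$ near $0$) $$\frac{1}{1-xt}E\big[e^{-Yt}\big]=\sum_{n=0}^{\infty}d_{n}^{Y}(x)\frac{t^{n}}{n!}.$$ Here ${n \brace k}$ are the (ordinary) Stirling numbers of the second kind, given by $\frac{1}{k!}(e^{t}-1)^{k}=\sum_{n=k}^{\infty}{n \brace k}\frac{t^{n}}{n!}$, and the Fubini polynomials are $$F_{n}(x)=\sum_{k=0}^{n}{n \brace k}k!\,x^{k},\quad n\ge 0.$$ *)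

theory Defs
  imports "HOL-Probability.Probability" "HOL-Combinatorics.Stirling"
    "HOL-Computational_Algebra.Formal_Power_Series"
begin

text \<open>
  The library function \<open>Stirling\<close> (Stirling numbers of the second kind) is defined by its
  recurrence; it has the exponential generating function \<open>(e\<^sup>t - 1)\<^sup>k / k!\<close>.
\<close>

lemma Stirling_egf:
  "Abs_fps (\<lambda>n. of_nat (Stirling n k) / fact n) =
     fps_const (1 / fact k) * (fps_exp 1 - 1 :: 'a :: field_char_0 fps) ^ k"
proof (induction k)
  case 0
  show ?case
  proof (rule fps_ext)
    fix n show "fps_nth (Abs_fps (\<lambda>n. of_nat (Stirling n 0) / fact n)) n =
      fps_nth (fps_const (1 / fact 0) * (fps_exp 1 - 1 :: 'a fps) ^ 0) n"
      by (cases n) auto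
  qed
next
  case (Suc k)
  let ?A = "Abs_fps (\<lambda>n. of_nat (Stirling n (Suc k)) / fact n) :: 'a fps"
  let ?B = "fps_const (1 / fact (Suc k)) * (fps_exp 1 - 1 :: 'a fps) ^ Suc k"
  let ?C = "fps_const (1 / fact k) * (fps_exp 1 - 1 :: 'a fps) ^ k"
  have recA: "fps_deriv ?A = of_nat (Suc k) * ?A + ?C"
    unfolding Suc.IH [symmetric]
    by (rule fps_ext)
      (simp add: fps_of_nat [symmetric] divide_simps del: of_nat_Suc, simp add: algebra_simps)
  have "fps_deriv ?B = fps_const (1 / fact (Suc k)) * (of_nat (Suc k) *
      (fps_exp 1 * (fps_exp 1 - 1 :: 'a fps) ^ k))"
    by (simp only: fps_deriv_mult fps_deriv_power fps_deriv_sub)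
      (simp add: fps_of_nat mult_ac del: fact_Suc power_Suc of_nat_Suc)
  also have "\<dots> = of_nat (Suc k) * fps_const (1 / fact (Suc k)) *
      ((fps_exp 1 - 1) * (fps_exp 1 - 1 :: 'a fps) ^ k + (fps_exp 1 - 1) ^ k)"
    by (simp add: algebra_simps)
  also have "\<dots> = of_nat (Suc k) * ?B +
      (of_nat (Suc k) * fps_const (1 / fact (Suc k))) * (fps_exp 1 - 1 :: 'a fps) ^ k"
    by (simp only: power_Suc distrib_left mult.assoc)
  also have "of_nat (Suc k) * fps_const (1 / fact (Suc k) :: 'a) = fps_const (1 / fact k)"
    unfolding fps_of_nat [symmetric] fps_const_mult
    by (simp add: divide_simps del: of_nat_Suc)
  finally have recB: "fps_deriv ?B = of_nat (Suc k) * ?B + ?C" .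
  show ?case
  proof (rule fps_ext)
    fix n show "fps_nth ?A n = fps_nth ?B n"
    proof (induction n)
      case 0
      show ?case by (simp add: fps_power_zeroth)
    next
      case (Suc n)
      have "fps_nth (fps_deriv ?A) n = fps_nth (fps_deriv ?B) n"
        unfolding recA recB
        using Suc by (simp only: fps_add_nth fps_of_nat [symmetric] fps_mult_left_const_nth)
      then have "of_nat (Suc n) * fps_nth ?A (Suc n) = of_nat (Suc n) * fps_nth ?B (Suc n)"
        by (simp only: fps_deriv_nth Suc_eq_plus1)
      then show ?case
        by (simp only: mult_cancel_left of_nat_eq_0_iff) simp
    qed
  qed
qed

definition fubini_poly :: "nat \<Rightarrow> real \<Rightarrow> real" where
  "fubini_poly n x = (\<Sum>k=0..n. real (Stirling n k) * fact k * x ^ k)"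

text \<open>
  The values \<open>d\<^sub>n(x)\<close> for fixed \<open>x\<close>, as the unique sequence with the given exponential generating
  function. Uniqueness always holds (identity theorem for power series); existence holds when the
  moment generating function of \<open>Y\<close> is finite near \<open>0\<close>.
\<close>

definition prob_derangement2 :: "'a measure \<Rightarrow> ('a \<Rightarrow> real) \<Rightarrow> nat \<Rightarrow> real \<Rightarrow> real" where
  "prob_derangement2 M Y n x =
     (THE d :: nat \<Rightarrow> real. \<forall>\<^sub>F t in nhds 0.
        (\<lambda>k. d k * (t ^ k / fact k)) sums
          (1 / (1 - x * t) * (\<integral>\<omega>. exp (- Y \<omega> * t) \<partial>M))) n"

end

theory Submission
  imports Defs
begin

text \<open>
  The idea is that both sides, divided by \<open>n!\<close>, are the coefficients of the same formal power series.
  Let \<open>D(t) = \<Sum>\<^sub>n d\<^sub>n(x) t\<^sup>n / n!\<close>. The defining identity of \<open>d\<^sub>n(x)\<close> factorises \<open>D\<close>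
  into the geometric series \<open>\<Sum>\<^sub>n x\<^sup>n t\<^sup>n\<close> and the exponential generating function of the
  signed moments \<open>(-1)\<^sup>l E[Y\<^sup>l]\<close>; this is \<open>prob_derangement2_egf\<close>. It is the only place
  where analysis enters: near \<open>0\<close> the moment generating function is the sum of its moment series
  (dominated convergence), a product of convergent series is represented by the formal product, and
  a function has at most one power series expansion at \<open>0\<close>.

  The rest is formal. Substituting \<open>e\<^sup>t - 1\<close> for \<open>t\<close> in an exponential generating function
  replaces a sequence \<open>a\<close> by its Stirling transform \<open>n \<mapsto> \<Sum>\<^sub>m a\<^sub>m S(n,m)\<close>
  (\<open>stirling_transform_egf\<close>), and substitution commutes with products. Hence the Stirling transform
  of \<open>d\<^sub>n(x)\<close> is the binomial convolution of the Stirling transform of the signed moments with the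
  Stirling transform of \<open>k! x\<^sup>k\<close>, which consists of the Fubini polynomials.
\<close>

section \<open>Real functions and their power series\<close>

text \<open>A power series that converges on a neighbourhood of \<open>0\<close> has a positive radius of convergence,
  because that neighbourhood contains some \<open>t > 0\<close>.\<close>

lemma has_fps_expansion_iff_eventually_sums:
  fixes f :: "real \<Rightarrow> real"
  shows "f has_fps_expansion F \<longleftrightarrow> (\<forall>\<^sub>F t in nhds 0. (\<lambda>k. fps_nth F k * t ^ k) sums f t)"
proof
  assume F: "f has_fps_expansion F"
  then have "\<forall>\<^sub>F t in nhds 0. t \<in> eball 0 (fps_conv_radius F)"
    by (intro eventually_nhds_in_open) (auto simp: has_fps_expansion_def zero_ereal_def)
  moreover have "\<forall>\<^sub>F t in nhds 0. eval_fps F t = f t"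
    using F by (simp add: has_fps_expansion_def)
  ultimately show "\<forall>\<^sub>F t in nhds 0. (\<lambda>k. fps_nth F k * t ^ k) sums f t"
  proof eventually_elim
    case (elim t)
    then show ?case using sums_eval_fps[of t F] by (simp add: in_eball_iff)
  qed
next
  assume S: "\<forall>\<^sub>F t in nhds 0. (\<lambda>k. fps_nth F k * t ^ k) sums f t"
  then obtain e where e: "e > 0" "\<And>t. \<bar>t\<bar> < e \<Longrightarrow> (\<lambda>k. fps_nth F k * t ^ k) sums f t"
    unfolding eventually_nhds_metric by (auto simp: dist_real_def)
  have "conv_radius (fps_nth F) \<ge> norm (e / 2)"
    using e(1) by (intro conv_radius_geI[OF sums_summable[OF e(2)]]) auto
  then have "fps_conv_radius F > 0"
    using e(1) unfolding fps_conv_radius_def by (elim less_le_trans[rotated]) simp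
  moreover have "\<forall>\<^sub>F t in nhds 0. eval_fps F t = f t"
    using S by eventually_elim (simp add: eval_fps_def sums_iff)
  ultimately show "f has_fps_expansion F"
    by (simp add: has_fps_expansion_def)
qed

text \<open>If a power series vanishes near \<open>0\<close>, dividing by the power of \<open>t\<close> that belongs to its first
  nonzero coefficient and letting \<open>t\<close> tend to \<open>0\<close> shows that this coefficient is zero.\<close>

lemma has_fps_expansion_zero_imp_zero_real:
  fixes F :: "real fps"
  assumes "(\<lambda>_. 0) has_fps_expansion F"
  shows "F = 0"
proof (rule ccontr)
  assume "F \<noteq> 0"
  define m where "m = subdegree F"
  obtain e where e: "e > 0" "\<And>t. \<bar>t\<bar> < e \<Longrightarrow> (\<lambda>k. fps_nth F k * t ^ k) sums 0"
    using assms unfolding has_fps_expansion_iff_eventually_sums eventually_nhds_metric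
    by (auto simp: dist_real_def)
  have "(\<lambda>k. fps_nth F (k + m) * t ^ k) sums 0" if "t \<noteq> 0" "\<bar>t\<bar> < e" for t
  proof -
    have "(\<lambda>k. fps_nth F (k + m) * t ^ (k + m)) sums 0"
    proof (rule iffD2[OF sums_iff_shift])
      have "(\<Sum>k<m. fps_nth F k * t ^ k) = 0"
        by (intro sum.neutral) (auto simp: m_def)
      then show "(\<lambda>k. fps_nth F k * t ^ k) sums (0 + (\<Sum>k<m. fps_nth F k * t ^ k))"
        using e(2)[OF that(2)] by (simp only: add_0_left)
    qed
    from sums_divide[OF this, of "t ^ m"] show ?thesis
      using that by (simp add: power_add)
  qed
  then have "((\<lambda>_. 0) \<longlongrightarrow> fps_nth F (0 + m)) (at (0::real))"
    using e(1) by (intro powser_limit_0_strong[where s = e]) auto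
  then have "fps_nth F m = 0"
    using tendsto_unique[of "at (0::real)" "\<lambda>_. 0" "fps_nth F m" 0] by simp
  then show False
    using \<open>F \<noteq> 0\<close> by (simp add: m_def)
qed

lemma has_fps_expansion_unique_real:
  fixes f :: "real \<Rightarrow> real"
  assumes "f has_fps_expansion F" "f has_fps_expansion G"
  shows "F = G"
  using has_fps_expansion_zero_imp_zero_real[of "F - G"] has_fps_expansion_diff[OF assms] by simp

lemma has_fps_expansion_geometric_real:
  "(\<lambda>t::real. 1 / (1 - x * t)) has_fps_expansion Abs_fps (\<lambda>n. x ^ n)"
  unfolding has_fps_expansion_iff_eventually_sums
proof -
  have "((\<lambda>t. x * t) \<longlongrightarrow> x * 0) (nhds 0)"
    by (intro tendsto_intros filterlim_ident)
  from tendstoD[OF this, of 1] have "\<forall>\<^sub>F t in nhds 0. \<bar>x * t\<bar> < 1"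
    by (simp add: dist_real_def)
  then show "\<forall>\<^sub>F t in nhds 0. (\<lambda>k. fps_nth (Abs_fps (\<lambda>n. x ^ n)) k * t ^ k) sums (1 / (1 - x * t))"
  proof eventually_elim
    case (elim t)
    then show ?case using geometric_sums[of "x * t"] by (simp add: power_mult_distrib)
  qed
qed

section \<open>The moment series of a moment generating function\<close>

lemma abs_power_div_fact_sum_le_exp:
  fixes y :: real
  shows "(\<Sum>k<n. \<bar>y\<bar> ^ k / fact k) \<le> exp \<bar>y\<bar>"
  using sum_le_suminf[OF summable_exp[of "\<bar>y\<bar>"], of "{..<n}"]
  by (auto simp: exp_def divide_inverse mult.commute)

text \<open>This follows from \<open>e\<^bsup>|y|\<^esup> \<le> e\<^sup>y + e\<^bsup>-y\<^esup>\<close>, which is why the moment generating function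
  is required on both sides of \<open>0\<close>.\<close>

lemma integrable_exp_abs:
  fixes Y :: "'a \<Rightarrow> real"
  assumes "Y \<in> borel_measurable M"
    and "integrable M (\<lambda>\<omega>. exp (t * Y \<omega>))" "integrable M (\<lambda>\<omega>. exp (- t * Y \<omega>))"
  shows "integrable M (\<lambda>\<omega>. exp \<bar>t * Y \<omega>\<bar>)"
proof (rule Bochner_Integration.integrable_bound[OF Bochner_Integration.integrable_add[OF assms(2,3)]])
  show "(\<lambda>\<omega>. exp \<bar>t * Y \<omega>\<bar>) \<in> borel_measurable M"
    using assms(1) by measurable
  have "norm (exp \<bar>y\<bar>) \<le> norm (exp y + exp (- y))" for y :: real
    using exp_gt_zero[of y] exp_gt_zero[of "- y"] by (auto simp: abs_if simp del: exp_gt_zero)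
  then show "AE \<omega> in M. norm (exp \<bar>t * Y \<omega>\<bar>) \<le> norm (exp (t * Y \<omega>) + exp (- t * Y \<omega>))"
    by simp
qed

text \<open>All partial sums of the exponential series of \<open>t Y\<close> are dominated by \<open>e\<^bsup>|t Y|\<^esup>\<close>, so the
  series may be integrated term by term.\<close>

lemma mgf_sums_moments:
  fixes Y :: "'a \<Rightarrow> real"
  assumes [measurable]: "Y \<in> borel_measurable M"
    and int: "integrable M (\<lambda>\<omega>. exp \<bar>t * Y \<omega>\<bar>)"
  shows "(\<lambda>k. (\<integral>\<omega>. Y \<omega> ^ k \<partial>M) / fact k * t ^ k) sums (\<integral>\<omega>. exp (t * Y \<omega>) \<partial>M)"
proof -
  have term_int: "integrable M (\<lambda>\<omega>. (t * Y \<omega>) ^ k / fact k)" for k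
  proof (rule Bochner_Integration.integrable_bound[OF int])
    have "norm (y ^ k / fact k) \<le> norm (exp \<bar>y\<bar>)" for y :: real
    proof -
      have "\<bar>y\<bar> ^ k / fact k \<le> (\<Sum>k<Suc k. \<bar>y\<bar> ^ k / fact k)"
        by (rule member_le_sum) auto
      also have "\<dots> \<le> exp \<bar>y\<bar>" by (rule abs_power_div_fact_sum_le_exp)
      finally show ?thesis by (simp add: power_abs)
    qed
    then show "AE \<omega> in M. norm ((t * Y \<omega>) ^ k / fact k) \<le> norm (exp \<bar>t * Y \<omega>\<bar>)"
      by simp
  qed simp
  have "(\<lambda>n. \<integral>\<omega>. (\<Sum>k<n. (t * Y \<omega>) ^ k / fact k) \<partial>M) \<longlonglongrightarrow> (\<integral>\<omega>. exp (t * Y \<omega>) \<partial>M)"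
  proof (rule integral_dominated_convergence[OF _ _ int])
    have "(\<lambda>n. \<Sum>k<n. y ^ k / fact k) \<longlonglongrightarrow> exp y" for y :: real
      using exp_converges[of y] by (simp add: sums_def divide_inverse mult.commute)
    then show "AE \<omega> in M. (\<lambda>n. \<Sum>k<n. (t * Y \<omega>) ^ k / fact k) \<longlonglongrightarrow> exp (t * Y \<omega>)"
      by simp
    have "norm (\<Sum>k<n. y ^ k / fact k) \<le> exp \<bar>y\<bar>" for y :: real and n
      using sum_norm_le[of "{..<n}" "\<lambda>k. y ^ k / fact k" "\<lambda>k. \<bar>y\<bar> ^ k / fact k"]
        abs_power_div_fact_sum_le_exp[of y n]
      by (auto simp: power_abs intro: order_trans)
    then show "AE \<omega> in M. norm (\<Sum>k<n. (t * Y \<omega>) ^ k / fact k) \<le> exp \<bar>t * Y \<omega>\<bar>" for n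
      by simp
  qed measurable
  moreover have "(\<integral>\<omega>. (\<Sum>k<n. (t * Y \<omega>) ^ k / fact k) \<partial>M) =
      (\<Sum>k<n. (\<integral>\<omega>. Y \<omega> ^ k \<partial>M) / fact k * t ^ k)" for n
    using term_int by (simp add: Bochner_Integration.integral_sum power_mult_distrib mult.commute)
  ultimately show ?thesis by (simp add: sums_def)
qed

lemma has_fps_expansion_mgf:
  fixes Y :: "'a \<Rightarrow> real"
  assumes "Y \<in> borel_measurable M" "\<rho> > 0"
    and int: "\<And>t::real. \<bar>t\<bar> < \<rho> \<Longrightarrow> integrable M (\<lambda>\<omega>. exp (t * Y \<omega>))"
  shows "(\<lambda>t. \<integral>\<omega>. exp (t * Y \<omega>) \<partial>M) has_fps_expansion
    Abs_fps (\<lambda>k. (\<integral>\<omega>. Y \<omega> ^ k \<partial>M) / fact k)"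
  unfolding has_fps_expansion_iff_eventually_sums eventually_nhds_metric
proof (intro exI[of _ \<rho>] conjI allI impI)
  fix t :: real
  assume "dist t 0 < \<rho>"
  then have "integrable M (\<lambda>\<omega>. exp \<bar>t * Y \<omega>\<bar>)"
    using int[of t] int[of "- t"] assms(1) by (intro integrable_exp_abs) (auto simp: dist_real_def)
  from mgf_sums_moments[OF assms(1) this]
  show "(\<lambda>k. fps_nth (Abs_fps (\<lambda>k. (\<integral>\<omega>. Y \<omega> ^ k \<partial>M) / fact k)) k * t ^ k) sums
      (\<integral>\<omega>. exp (t * Y \<omega>) \<partial>M)"
    by simp
qed (fact \<open>\<rho> > 0\<close>)

section \<open>Exponential generating functions\<close>

text \<open>Uniqueness of power series expansions makes the definite description in
  \<open>prob_derangement2\<close> well defined as soon as one expansion is known.\<close>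

lemma prob_derangement2_eqI:
  assumes "(\<lambda>t. 1 / (1 - x * t) * (\<integral>\<omega>. exp (- Y \<omega> * t) \<partial>M)) has_fps_expansion
    Abs_fps (\<lambda>n. d n / fact n)"
  shows "prob_derangement2 M Y n x = d n"
proof -
  let ?f = "\<lambda>t. 1 / (1 - x * t) * (\<integral>\<omega>. exp (- Y \<omega> * t) \<partial>M)"
  have iff: "(\<forall>\<^sub>F t in nhds 0. (\<lambda>k. c k * (t ^ k / fact k)) sums ?f t) \<longleftrightarrow>
      ?f has_fps_expansion Abs_fps (\<lambda>n. c n / fact n)" for c
    by (simp add: has_fps_expansion_iff_eventually_sums)
  have "c = d" if "?f has_fps_expansion Abs_fps (\<lambda>n. c n / fact n)" for c
    using has_fps_expansion_unique_real[OF that assms] by (auto simp: fps_eq_iff)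
  with assms have "(THE c. ?f has_fps_expansion Abs_fps (\<lambda>n. c n / fact n)) = d"
    by (rule the_equality)
  then show ?thesis
    by (simp only: prob_derangement2_def iff)
qed

text \<open>Expanding \<open>E[e\<^bsup>-Yt\<^esup>]\<close> in moments turns the defining identity of the derangement
  polynomials into an identity of formal power series.\<close>

lemma prob_derangement2_egf:
  fixes Y :: "'a \<Rightarrow> real"
  assumes "Y \<in> borel_measurable M" "\<rho> > 0"
    and int: "\<And>t::real. \<bar>t\<bar> < \<rho> \<Longrightarrow> integrable M (\<lambda>\<omega>. exp (t * Y \<omega>))"
  shows "Abs_fps (\<lambda>n. prob_derangement2 M Y n x / fact n) =
    Abs_fps (\<lambda>n. (-1) ^ n * (\<integral>\<omega>. Y \<omega> ^ n \<partial>M) / fact n) * Abs_fps (\<lambda>n. x ^ n)"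
    (is "_ = ?A * ?G")
proof -
  have "(\<lambda>t. \<integral>\<omega>. exp (t * - Y \<omega>) \<partial>M) has_fps_expansion
      Abs_fps (\<lambda>n. (\<integral>\<omega>. (- Y \<omega>) ^ n \<partial>M) / fact n)"
  proof (rule has_fps_expansion_mgf[OF _ assms(2)])
    show "(\<lambda>\<omega>. - Y \<omega>) \<in> borel_measurable M"
      using assms(1) by measurable
    show "integrable M (\<lambda>\<omega>. exp (t * - Y \<omega>))" if "\<bar>t\<bar> < \<rho>" for t
      using int[of "- t"] that by simp
  qed
  moreover have "(\<integral>\<omega>. exp (t * - Y \<omega>) \<partial>M) = (\<integral>\<omega>. exp (- Y \<omega> * t) \<partial>M)" for t
    by (simp only: mult.commute)
  moreover have "(\<integral>\<omega>. (- Y \<omega>) ^ n \<partial>M) = (-1) ^ n * (\<integral>\<omega>. Y \<omega> ^ n \<partial>M)" for n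
    unfolding power_minus[of "Y _"] by (rule integral_mult_right_zero)
  ultimately have "(\<lambda>t. \<integral>\<omega>. exp (- Y \<omega> * t) \<partial>M) has_fps_expansion ?A"
    by (simp only:)
  then have "(\<lambda>t. 1 / (1 - x * t) * (\<integral>\<omega>. exp (- Y \<omega> * t) \<partial>M)) has_fps_expansion ?G * ?A"
    by (rule has_fps_expansion_mult[OF has_fps_expansion_geometric_real])
  \<comment> \<open>every power series is the exponential generating function of \<open>n!\<close> times its coefficients\<close>
  then have "(\<lambda>t. 1 / (1 - x * t) * (\<integral>\<omega>. exp (- Y \<omega> * t) \<partial>M)) has_fps_expansion
      Abs_fps (\<lambda>n. (fact n * fps_nth (?G * ?A) n) / fact n)"
    by (simp only: nonzero_mult_div_cancel_left[OF fact_nonzero] fps_nth_inverse)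
  from prob_derangement2_eqI[OF this] show ?thesis
    by (simp add: fps_eq_iff mult.commute)
qed

text \<open>The powers \<open>(e\<^sup>t - 1)\<^sup>m / m!\<close> that occur in the composition are the exponential generating
  functions of the columns \<open>S(n,m)\<close> of the Stirling triangle.\<close>

lemma stirling_transform_egf:
  fixes a :: "nat \<Rightarrow> 'a :: field_char_0"
  shows "Abs_fps (\<lambda>n. a n / fact n) oo (fps_exp 1 - 1) =
    Abs_fps (\<lambda>n. (\<Sum>m=0..n. a m * of_nat (Stirling n m)) / fact n)"
proof (rule fps_ext)
  fix n
  have col: "fps_nth ((fps_exp 1 - 1 :: 'a fps) ^ m) n / fact m = of_nat (Stirling n m) / fact n" for m
    using arg_cong[OF Stirling_egf[of m], of "\<lambda>F. fps_nth F n", symmetric] by simp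
  have "fps_nth (Abs_fps (\<lambda>n. a n / fact n) oo (fps_exp 1 - 1)) n =
      (\<Sum>m=0..n. a m * (fps_nth ((fps_exp 1 - 1) ^ m) n / fact m))"
    by (simp add: fps_compose_nth)
  also have "\<dots> = (\<Sum>m=0..n. a m * of_nat (Stirling n m)) / fact n"
    by (simp add: col sum_divide_distrib)
  finally show "fps_nth (Abs_fps (\<lambda>n. a n / fact n) oo (fps_exp 1 - 1)) n =
      fps_nth (Abs_fps (\<lambda>n. (\<Sum>m=0..n. a m * of_nat (Stirling n m)) / fact n)) n"
    by simp
qed

text \<open>The Fubini polynomials are the Stirling transform of \<open>k! x\<^sup>k\<close>, whose exponential generating
  function is the geometric series.\<close>

lemma fubini_poly_egf:
  "Abs_fps (\<lambda>n. x ^ n) oo (fps_exp 1 - 1) = Abs_fps (\<lambda>n. fubini_poly n x / fact n)"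
  using stirling_transform_egf[of "\<lambda>n. fact n * x ^ n"]
  by (simp add: fubini_poly_def mult_ac)

lemma egf_mult_nth:
  fixes a b :: "nat \<Rightarrow> 'a :: field_char_0"
  shows "fact n * fps_nth (Abs_fps (\<lambda>n. a n / fact n) * Abs_fps (\<lambda>n. b n / fact n)) n =
    (\<Sum>m=0..n. of_nat (n choose m) * a m * b (n - m))"
  unfolding fps_mult_nth sum_distrib_left
  by (rule sum.cong) (auto simp: binomial_fact field_simps)

section \<open>The Stirling transform of the derangement polynomials\<close>

theorem theorem2p10:
  fixes M :: "'a measure" and Y :: "'a \<Rightarrow> real" and \<rho> x :: real and n :: nat
  assumes "prob_space M"
    and "Y \<in> borel_measurable M"
    and "\<rho> > 0"
    and "\<And>t::real. \<bar>t\<bar> < \<rho> \<Longrightarrow> integrable M (\<lambda>\<omega>. exp (t * Y \<omega>))"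
  shows "(\<Sum>m=0..n. prob_derangement2 M Y m x * real (Stirling n m)) =
    (\<Sum>m=0..n. \<Sum>l=0..m. (-1) ^ l * real (Stirling m l) * real (n choose m) *
       (\<integral>\<omega>. Y \<omega> ^ l \<partial>M) * fubini_poly (n - m) x)"
proof -
  let ?E = "fps_exp 1 - 1 :: real fps"
  let ?a = "\<lambda>l. (-1) ^ l * (\<integral>\<omega>. Y \<omega> ^ l \<partial>M)"
  have "Abs_fps (\<lambda>n. (\<Sum>m=0..n. prob_derangement2 M Y m x * real (Stirling n m)) / fact n) =
      Abs_fps (\<lambda>n. prob_derangement2 M Y n x / fact n) oo ?E"
    by (simp add: stirling_transform_egf)
  also have "\<dots> = (Abs_fps (\<lambda>n. ?a n / fact n) * Abs_fps (\<lambda>n. x ^ n)) oo ?E"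
    using prob_derangement2_egf[OF assms(2-4)] by simp
  also have "\<dots> = (Abs_fps (\<lambda>n. ?a n / fact n) oo ?E) * (Abs_fps (\<lambda>n. x ^ n) oo ?E)"
    by (rule fps_compose_mult_distrib) simp
  also have "\<dots> = Abs_fps (\<lambda>n. (\<Sum>l=0..n. ?a l * real (Stirling n l)) / fact n) *
      Abs_fps (\<lambda>n. fubini_poly n x / fact n)"
    by (simp only: stirling_transform_egf fubini_poly_egf)
  finally have eq: "Abs_fps (\<lambda>n. (\<Sum>m=0..n. prob_derangement2 M Y m x * real (Stirling n m)) / fact n) =
      Abs_fps (\<lambda>n. (\<Sum>l=0..n. ?a l * real (Stirling n l)) / fact n) *
      Abs_fps (\<lambda>n. fubini_poly n x / fact n)" .
  have "(\<Sum>m=0..n. prob_derangement2 M Y m x * real (Stirling n m)) =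
      (\<Sum>m=0..n. real (n choose m) * (\<Sum>l=0..m. ?a l * real (Stirling m l)) * fubini_poly (n - m) x)"
    using arg_cong[OF eq, of "\<lambda>F. fact n * fps_nth F n"] by (simp only: egf_mult_nth) simp
  also have "\<dots> = (\<Sum>m=0..n. \<Sum>l=0..m. (-1) ^ l * real (Stirling m l) * real (n choose m) *
       (\<integral>\<omega>. Y \<omega> ^ l \<partial>M) * fubini_poly (n - m) x)"
    by (simp add: sum_distrib_left sum_distrib_right mult_ac)
  finally show ?thesis .
qed

end
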